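(* Let $a\in\mathbb R\setminus\mathbb Q$ have finite irrationality measure $\mu(a)$, and let $L=\partial_t-a\,\partial_x$ on $\mathbb T^2$. If $r<\mu(a)$, then for every $k_1,k_2\in\mathbb R$ there exist $f\in H_{\mathrm{mix}}^{(k_1,k_2)}(\mathbb T^2)$ and $u\in\mathcal D'(\mathbb T^2)$ such that $Lu=f$ and, for every $\theta\in\mathbb R$, $$u\notin H_{\mathrm{mix}}^{(k_1+\theta,\,k_2+1-r-\theta)}(\mathbb T^2).$$ In particular, the conclusion $u\in H_{\mathrm{mix}}^{(k_1+\theta,\,k_2+1-r-\theta)}(\mathbb T^2)$ fails simultaneously for every $\theta\in[-r,1]$.
   Context: $\mathbb T=\mathbb R/2\pi\mathbb Z$, with variables $(t,x)\in\mathbb T^2$ and dual frequencies $(\tau,\xi)\in\mathbb Z^2$. $\mathcal D'(\mathbb T^2)$ is the space of distributions on $\mathbb T^2$. Fourier coefficients are $\widehat f(\tau,\xi)=\frac1{(2\pi)^2}\int_{\mathbb T^2}f(t,x)e^{-i(t\tau+x\xi)}\,dt\,dx$ (by duality for distributions). $\langle w\rangle=(1+|w|^2)^{1/2}$. For $s_1,s_2\in\mathbb R$, $H_{\mathrm{mix}}^{(s_1,s_2)}(\mathbb T^2)$ is the space of $f\in\mathcal D'(\mathbb T^2)$ with $\sum_{(\tau,\xi)\in\mathbb Z^2}\langle\tau\rangle^{2s_1}\langle\xi\rangle^{2s_2}|\widehat f(\tau,\xi)|^2<\infty$. The irrationality measure of $a\in\mathbb R\setminus\mathbb Q$ is $\mu(a)=\sup\{\nu>0:\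 |a-p/q|<q^{-\nu}\text{ for infinitely many }(p,q)\in\mathbb Z\times\mathbb N\}\in[2,\infty]$. *)

theory Defs
  imports "HOL-Analysis.Analysis"
begin

text \<open>
  Functions on the torus are functions on the plane that are
  \<open>2 * pi\<close>-periodic in each of the variables \<open>(t, x)\<close>.
\<close>

definition biperiodic :: "(real \<times> real \<Rightarrow> complex) \<Rightarrow> bool" where
  "biperiodic \<phi> \<longleftrightarrow>
     (\<forall>t x. \<phi> (t + 2 * pi, x) = \<phi> (t, x) \<and> \<phi> (t, x + 2 * pi) = \<phi> (t, x))"

definition deriv_t :: "(real \<times> real \<Rightarrow> complex) \<Rightarrow> real \<times> real \<Rightarrow> complex" where
  "deriv_t \<phi> = (\<lambda>(t, x). vector_derivative (\<lambda>s. \<phi> (s, x)) (at t))"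

definition deriv_x :: "(real \<times> real \<Rightarrow> complex) \<Rightarrow> real \<times> real \<Rightarrow> complex" where
  "deriv_x \<phi> = (\<lambda>(t, x). vector_derivative (\<lambda>y. \<phi> (t, y)) (at x))"

primrec Ck :: "nat \<Rightarrow> (real \<times> real \<Rightarrow> complex) \<Rightarrow> bool" where
  "Ck 0 \<phi> \<longleftrightarrow> continuous_on UNIV \<phi>"
| "Ck (Suc k) \<phi> \<longleftrightarrow>
     continuous_on UNIV \<phi> \<and>
     (\<forall>t x. (\<lambda>s. \<phi> (s, x)) differentiable (at t) \<and> (\<lambda>y. \<phi> (t, y)) differentiable (at x)) \<and>
     Ck k (deriv_t \<phi>) \<and> Ck k (deriv_x \<phi>)"

definition test_functions :: "(real \<times> real \<Rightarrow> complex) set" where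
  "test_functions = {\<phi>. biperiodic \<phi> \<and> (\<forall>k. Ck k \<phi>)}"

definition Ck_norm :: "nat \<Rightarrow> (real \<times> real \<Rightarrow> complex) \<Rightarrow> real" where
  "Ck_norm N \<phi> =
     (\<Sum>(i, j)\<in>{(i, j). i + j \<le> N}. SUP z. cmod ((deriv_t ^^ i) ((deriv_x ^^ j) \<phi>) z))"

text \<open>
  Distributions are the linear functionals on test functions that are continuous for the
  Frechet topology given by the norms \<open>Ck_norm N\<close>.  Requiring extensionality (a fixed dummy
  value off \<open>test_functions\<close>) makes equality of distributions coincide with HOL equality.
\<close>

definition distributions :: "((real \<times> real \<Rightarrow> complex) \<Rightarrow> complex) set" where
  "distributions = {u \<in> extensional test_functions.
     (\<forall>\<phi>\<in>test_functions. \<forall>\<psi>\<in>test_functions. u (\<lambda>z. \<phi> z + \<psi> z) = u \<phi> + u \<psi>) \<and>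
     (\<forall>c. \<forall>\<phi>\<in>test_functions. u (\<lambda>z. c * \<phi> z) = c * u \<phi>) \<and>
     (\<exists>N C. \<forall>\<phi>\<in>test_functions. cmod (u \<phi>) \<le> C * Ck_norm N \<phi>)}"

definition dist_deriv_t ::
  "((real \<times> real \<Rightarrow> complex) \<Rightarrow> complex) \<Rightarrow> (real \<times> real \<Rightarrow> complex) \<Rightarrow> complex" where
  "dist_deriv_t u = (\<lambda>\<phi>\<in>test_functions. - u (deriv_t \<phi>))"

definition dist_deriv_x ::
  "((real \<times> real \<Rightarrow> complex) \<Rightarrow> complex) \<Rightarrow> (real \<times> real \<Rightarrow> complex) \<Rightarrow> complex" where
  "dist_deriv_x u = (\<lambda>\<phi>\<in>test_functions. - u (deriv_x \<phi>))"

text \<open>The operator \<open>L = d/dt - a d/dx\<close> acting on distributions.\<close>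

definition transport_op ::
  "real \<Rightarrow> ((real \<times> real \<Rightarrow> complex) \<Rightarrow> complex) \<Rightarrow> (real \<times> real \<Rightarrow> complex) \<Rightarrow> complex" where
  "transport_op a u =
     (\<lambda>\<phi>\<in>test_functions. dist_deriv_t u \<phi> - complex_of_real a * dist_deriv_x u \<phi>)"

definition torus_exp :: "int \<Rightarrow> int \<Rightarrow> real \<times> real \<Rightarrow> complex" where
  "torus_exp \<tau> \<xi> = (\<lambda>(t, x). exp (\<i> * complex_of_real (t * of_int \<tau> + x * of_int \<xi>)))"

text \<open>
  A function \<open>f\<close> is identified with the functional that maps \<open>\<phi>\<close> to the integral of \<open>f * \<phi>\<close>
  (bilinear pairing, no conjugation), whence the negated frequencies.
\<close>

definition dist_fourier ::
  "((real \<times> real \<Rightarrow> complex) \<Rightarrow> complex) \<Rightarrow> int \<Rightarrow> int \<Rightarrow> complex" where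
  "dist_fourier u \<tau> \<xi> = u (torus_exp (- \<tau>) (- \<xi>)) / complex_of_real ((2 * pi)\<^sup>2)"

definition jap :: "real \<Rightarrow> real" where
  "jap w = sqrt (1 + \<bar>w\<bar>\<^sup>2)"

definition H_mix :: "real \<Rightarrow> real \<Rightarrow> ((real \<times> real \<Rightarrow> complex) \<Rightarrow> complex) set" where
  "H_mix s1 s2 = {f \<in> distributions.
     (\<lambda>(\<tau>, \<xi>). jap (of_int \<tau>) powr (2 * s1) * jap (of_int \<xi>) powr (2 * s2) *
        (cmod (dist_fourier f \<tau> \<xi>))\<^sup>2) summable_on (UNIV :: (int \<times> int) set)}"

definition irrationality_measure :: "real \<Rightarrow> ereal" where
  "irrationality_measure a =
     Sup (ereal ` {\<nu>. \<nu> > 0 \<and>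
       infinite {(p :: int, q :: nat). q > 0 \<and> \<bar>a - of_int p / real q\<bar> < real q powr (- \<nu>)}})"

end

theory Submission
  imports Defs
begin

text \<open>
  Fix \<open>r < \<nu>\<close> such that infinitely many fractions satisfy \<open>\<bar>a - p / q\<bar> < q powr (- \<nu>)\<close>, and let \<open>u\<close> be
  a Fourier series supported on a lacunary sequence of such frequencies \<open>(p, q)\<close>, on which the
  symbol \<open>p - a q\<close> of the operator is at most \<open>q powr (1 - \<nu>)\<close>.  As \<open>\<bar>p\<bar>\<close> and \<open>q\<close> are comparable there,
  the shift \<open>\<theta>\<close> changes the weights only by bounded factors.  The coefficients of \<open>u\<close> are normalised
  so that the terms of its square norm of order \<open>(k1 + \<theta>, k2 + 1 - r - \<theta>)\<close> stay bounded below; the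
  terms of the square norm of \<open>L u\<close> of order \<open>(k1, k2)\<close> are then at most \<open>q powr (- 2 * (\<nu> - r))\<close>,
  hence summable when \<open>q\<close> grows geometrically.
\<close>

subsection \<open>Test functions\<close>

lemma Ck_continuous: "Ck k \<phi> \<Longrightarrow> continuous_on UNIV \<phi>"
  by (cases k) auto

lemma test_function_continuous: "\<phi> \<in> test_functions \<Longrightarrow> continuous_on UNIV \<phi>"
  using Ck_continuous by (auto simp: test_functions_def)

lemma test_function_differentiable:
  assumes "\<phi> \<in> test_functions"
  shows "((\<lambda>s. \<phi> (s, x)) has_vector_derivative deriv_t \<phi> (t, x)) (at t)"
    and "((\<lambda>y. \<phi> (t, y)) has_vector_derivative deriv_x \<phi> (t, x)) (at x)"
proof -
  have "Ck (Suc 0) \<phi>" using assms by (auto simp: test_functions_def)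
  then have "(\<lambda>s. \<phi> (s, x)) differentiable (at t)" "(\<lambda>y. \<phi> (t, y)) differentiable (at x)" by auto
  then show "((\<lambda>s. \<phi> (s, x)) has_vector_derivative deriv_t \<phi> (t, x)) (at t)"
    and "((\<lambda>y. \<phi> (t, y)) has_vector_derivative deriv_x \<phi> (t, x)) (at x)"
    by (simp_all add: deriv_t_def deriv_x_def vector_derivative_works)
qed

lemma biperiodicD:
  assumes "biperiodic \<phi>"
  shows "\<phi> (t + 2 * pi, x) = \<phi> (t, x)" "\<phi> (t, x + 2 * pi) = \<phi> (t, x)"
  using assms by (auto simp: biperiodic_def)

lemma test_function_biperiodic: "\<phi> \<in> test_functions \<Longrightarrow> biperiodic \<phi>"
  by (simp add: test_functions_def)

text \<open>By the chain rule the translate of \<open>g\<close> by \<open>c\<close> has derivative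
  \<open>g' (s + c)\<close> at \<open>s\<close>; the translate is \<open>g\<close> itself, so
  uniqueness of derivatives applies.\<close>

lemma vector_derivative_shift:
  fixes g :: "real \<Rightarrow> 'a :: real_normed_vector"
  assumes "\<And>s. (g has_vector_derivative g' s) (at s)" "\<And>s. g (s + c) = g s"
  shows "g' (s + c) = g' s"
proof -
  have "((\<lambda>s. g (s + c)) has_vector_derivative g' (s + c)) (at s)"
    using vector_diff_chain_at[of "\<lambda>s. s + c" 1 s g "g' (s + c)"] assms(1)[of "s + c"]
    by (simp add: o_def has_vector_derivative_add_const has_vector_derivative_id)
  then show ?thesis
    using assms(1)[of s] assms(2) by (simp add: vector_derivative_unique_at)
qed

lemma test_functions_deriv:
  assumes "\<phi> \<in> test_functions"
  shows "deriv_t \<phi> \<in> test_functions" "deriv_x \<phi> \<in> test_functions"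
proof -
  note d = test_function_differentiable[OF assms] and b = biperiodicD[OF test_function_biperiodic[OF assms]]
  have 1: "Ck (Suc k) \<phi>" for k using assms by (auto simp: test_functions_def)
  have "biperiodic (deriv_t \<phi>)"
    unfolding biperiodic_def
  proof (intro allI conjI)
    fix t x
    show "deriv_t \<phi> (t + 2 * pi, x) = deriv_t \<phi> (t, x)"
      by (rule vector_derivative_shift[of "\<lambda>s. \<phi> (s, x)" "\<lambda>s. deriv_t \<phi> (s, x)"]) (use d b in auto)
    show "deriv_t \<phi> (t, x + 2 * pi) = deriv_t \<phi> (t, x)"
      by (simp add: deriv_t_def b)
  qed
  then show "deriv_t \<phi> \<in> test_functions" using 1 by (auto simp: test_functions_def)
  have "biperiodic (deriv_x \<phi>)"
    unfolding biperiodic_def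
  proof (intro allI conjI)
    fix t x
    show "deriv_x \<phi> (t, x + 2 * pi) = deriv_x \<phi> (t, x)"
      by (rule vector_derivative_shift[of "\<lambda>y. \<phi> (t, y)" "\<lambda>y. deriv_x \<phi> (t, y)"]) (use d b in auto)
    show "deriv_x \<phi> (t + 2 * pi, x) = deriv_x \<phi> (t, x)"
      by (simp add: deriv_x_def b)
  qed
  then show "deriv_x \<phi> \<in> test_functions" using 1 by (auto simp: test_functions_def)
qed

lemma test_functions_funpow_deriv:
  assumes "\<phi> \<in> test_functions"
  shows "(deriv_t ^^ i) ((deriv_x ^^ j) \<phi>) \<in> test_functions"
proof -
  have "(deriv_x ^^ j) \<phi> \<in> test_functions"
    by (induction j) (auto simp: assms test_functions_deriv)
  then show ?thesis by (induction i) (auto simp: test_functions_deriv)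
qed

text \<open>Two coefficients treat sums and multiples at once. The functions vary in the induction
  because their partial derivatives take their place.\<close>

lemma Ck_linear:
  assumes "Ck k \<phi>" "Ck k \<psi>"
  shows "Ck k (\<lambda>z. c * \<phi> z + d * \<psi> z)"
  using assms
proof (induction k arbitrary: \<phi> \<psi>)
  case 0
  then show ?case by (auto intro!: continuous_intros)
next
  case (Suc k)
  have "deriv_t (\<lambda>z. c * \<phi> z + d * \<psi> z) = (\<lambda>z. c * deriv_t \<phi> z + d * deriv_t \<psi> z)"
    using Suc.prems
    by (auto simp: deriv_t_def vector_derivative_works fun_eq_iff
        intro!: vector_derivative_at derivative_eq_intros)
  moreover have "deriv_x (\<lambda>z. c * \<phi> z + d * \<psi> z) = (\<lambda>z. c * deriv_x \<phi> z + d * deriv_x \<psi> z)"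
    using Suc.prems
    by (auto simp: deriv_x_def vector_derivative_works fun_eq_iff
        intro!: vector_derivative_at derivative_eq_intros)
  ultimately show ?case
    using Suc by (auto intro!: continuous_intros)
qed

lemma test_functions_linear:
  assumes "\<phi> \<in> test_functions" "\<psi> \<in> test_functions"
  shows "(\<lambda>z. c * \<phi> z + d * \<psi> z) \<in> test_functions"
  using assms Ck_linear by (auto simp: test_functions_def biperiodic_def)

lemma torus_exp_deriv:
  "((\<lambda>s. torus_exp \<tau> \<xi> (s, x)) has_vector_derivative \<i> * of_int \<tau> * torus_exp \<tau> \<xi> (t, x)) (at t)"
  "((\<lambda>y. torus_exp \<tau> \<xi> (t, y)) has_vector_derivative \<i> * of_int \<xi> * torus_exp \<tau> \<xi> (t, x)) (at x)"
  unfolding torus_exp_def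
  by (auto intro!: derivative_eq_intros has_vector_derivative_real_field simp: algebra_simps)

lemma continuous_on_torus_exp [continuous_intros]: "continuous_on A (torus_exp \<tau> \<xi>)"
  unfolding torus_exp_def split_beta by (intro continuous_intros)

lemma biperiodic_torus_exp: "biperiodic (torus_exp \<tau> \<xi>)"
proof -
  have "exp (\<i> * complex_of_real (2 * pi * of_int n)) = 1" for n
    using exp_integer_2pi[of "of_int n"] by (simp add: mult_ac)
  then show ?thesis
    by (simp add: biperiodic_def torus_exp_def algebra_simps exp_add)
qed

lemma torus_exp_mult: "torus_exp \<tau> \<xi> z * torus_exp \<tau>' \<xi>' z = torus_exp (\<tau> + \<tau>') (\<xi> + \<xi>') z"
  by (cases z) (simp add: torus_exp_def algebra_simps exp_add)

lemma norm_torus_exp [simp]: "cmod (torus_exp \<tau> \<xi> z) = 1"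
  by (cases z) (simp only: torus_exp_def split norm_exp_i_times)

lemma test_functions_torus_exp: "torus_exp \<tau> \<xi> \<in> test_functions"
proof -
  have t: "deriv_t (\<lambda>z. c * torus_exp \<tau> \<xi> z) = (\<lambda>z. (c * \<i> * of_int \<tau>) * torus_exp \<tau> \<xi> z)" for c
    by (auto simp: deriv_t_def fun_eq_iff mult_ac
        intro!: vector_derivative_at derivative_eq_intros torus_exp_deriv)
  have x: "deriv_x (\<lambda>z. c * torus_exp \<tau> \<xi> z) = (\<lambda>z. (c * \<i> * of_int \<xi>) * torus_exp \<tau> \<xi> z)" for c
    by (auto simp: deriv_x_def fun_eq_iff mult_ac
        intro!: vector_derivative_at derivative_eq_intros torus_exp_deriv)
  \<comment> \<open>The scalar is generalised: differentiating turns a multiple of the exponential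
    into another multiple of it.\<close>
  have "Ck k (\<lambda>z. c * torus_exp \<tau> \<xi> z)" for k c
  proof (induction k arbitrary: c)
    case (Suc k)
    have "(\<lambda>s. c * torus_exp \<tau> \<xi> (s, v)) differentiable (at u)" for u v
      by (intro differentiable_mult differentiable_const differentiableI_vector[OF torus_exp_deriv(1)])
    moreover have "(\<lambda>y. c * torus_exp \<tau> \<xi> (u, y)) differentiable (at v)" for u v
      by (intro differentiable_mult differentiable_const differentiableI_vector[OF torus_exp_deriv(2)])
    ultimately show ?case
      using Suc by (simp add: t x continuous_intros)
  qed (simp add: continuous_intros)
  from this[of _ 1] show ?thesis by (simp add: test_functions_def biperiodic_torus_exp)
qed

text \<open>All values are already taken on a compact period square. This makes the suprema in
  \<open>Ck_norm\<close> genuine upper bounds.\<close>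

lemma biperiodic_bounded:
  assumes "biperiodic \<phi>" "continuous_on UNIV \<phi>"
  shows "bdd_above (range (\<lambda>z. cmod (\<phi> z)))"
proof -
  have "bounded (\<phi> ` cbox (0, 0) (2 * pi, 2 * pi))"
    by (intro compact_imp_bounded compact_continuous_image compact_cbox continuous_on_subset[OF assms(2)]) auto
  then obtain B where B: "\<And>z. z \<in> cbox (0, 0) (2 * pi, 2 * pi) \<Longrightarrow> cmod (\<phi> z) \<le> B"
    by (auto simp: bounded_iff)
  have nt: "\<phi> (t + 2 * pi * of_nat n, x) = \<phi> (t, x)" for n t x
  proof (induction n)
    case (Suc n)
    then show ?case
      using biperiodicD(1)[OF assms(1), of "t + 2 * pi * of_nat n" x] by (simp add: algebra_simps)
  qed simp
  have nx: "\<phi> (t, x + 2 * pi * of_nat n) = \<phi> (t, x)" for n t x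
  proof (induction n)
    case (Suc n)
    then show ?case
      using biperiodicD(2)[OF assms(1), of t "x + 2 * pi * of_nat n"] by (simp add: algebra_simps)
  qed simp
  \<comment> \<open>For negative \<open>n\<close>, shifting the translated point forward
    \<open>nat (-n)\<close> times leads back to \<open>t\<close>.\<close>
  have it: "\<phi> (t + 2 * pi * of_int n, x) = \<phi> (t, x)" for n t x
    using nt[of t "nat n" x] nt[of "t + 2 * pi * of_int n" "nat (-n)" x] by (cases "n \<ge> 0") auto
  have ix: "\<phi> (t, x + 2 * pi * of_int n) = \<phi> (t, x)" for n t x
    using nx[of t x "nat n"] nx[of t "x + 2 * pi * of_int n" "nat (-n)"] by (cases "n \<ge> 0") auto
  have fl: "t + 2 * pi * of_int (- \<lfloor>t / (2 * pi)\<rfloor>) \<in> {0..2 * pi}" for t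
  proof -
    have "of_int \<lfloor>t / (2 * pi)\<rfloor> * (2 * pi) \<le> t"
      using of_int_floor_le[of "t / (2 * pi)"] by (simp only: pos_le_divide_eq pi_gt_zero zero_less_mult_iff zero_less_numeral simp_thms)
    moreover have "t \<le> (of_int \<lfloor>t / (2 * pi)\<rfloor> + 1) * (2 * pi)"
      using real_of_int_floor_add_one_ge[of "t / (2 * pi)"] by (simp only: pos_divide_le_eq pi_gt_zero zero_less_mult_iff zero_less_numeral simp_thms)
    ultimately show ?thesis by (simp add: algebra_simps)
  qed
  have "cmod (\<phi> (t, x)) \<le> B" for t x
    using B[of "(t + 2 * pi * of_int (- \<lfloor>t / (2 * pi)\<rfloor>), x + 2 * pi * of_int (- \<lfloor>x / (2 * pi)\<rfloor>))"] fl[of t] fl[of x]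
    unfolding it ix by (auto simp: cbox_Pair_eq)
  then show ?thesis by (auto intro!: bdd_aboveI[of _ B])
qed

lemma finite_add_le: "finite {(i :: nat, j). i + j \<le> N}"
  by (rule finite_subset[of _ "{..N} \<times> {..N}"]) auto

text \<open>The summand with index \<open>(0, N)\<close> is at most the whole sum, the others being
  nonnegative.\<close>

lemma Ck_norm_deriv_x:
  assumes "\<phi> \<in> test_functions"
  shows "cmod ((deriv_x ^^ N) \<phi> z) \<le> Ck_norm N \<phi>"
proof -
  let ?S = "\<lambda>i j. SUP z. cmod ((deriv_t ^^ i) ((deriv_x ^^ j) \<phi>) z)"
  have bdd: "cmod ((deriv_t ^^ i) ((deriv_x ^^ j) \<phi>) z) \<le> ?S i j" for i j z
    by (intro cSUP_upper biperiodic_bounded test_function_biperiodic test_function_continuous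
        test_functions_funpow_deriv assms) auto
  have "?S i j \<ge> 0" for i j
    using bdd[of i j undefined] norm_ge_zero order_trans by blast
  then have "(\<Sum>(i, j)\<in>{(0, N)}. ?S i j) \<le> Ck_norm N \<phi>"
    unfolding Ck_norm_def by (intro sum_mono2 finite_add_le) auto
  then show ?thesis using bdd[of 0 N z] by simp
qed

subsection \<open>Integration over the torus\<close>

definition torus_integral :: "(real \<times> real \<Rightarrow> complex) \<Rightarrow> complex" where
  "torus_integral g = integral (cbox (0, 0) (2 * pi, 2 * pi)) g"

lemma integrable_torus:
  "continuous_on UNIV (g :: _ \<Rightarrow> complex) \<Longrightarrow> g integrable_on (cbox (0, 0) (2 * pi, 2 * pi :: real))"
  by (rule integrable_continuous) (auto intro: continuous_on_subset)

lemma torus_integral_linear: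
  assumes "continuous_on UNIV g" "continuous_on UNIV h"
  shows "torus_integral (\<lambda>z. c * g z + d * h z) = c * torus_integral g + d * torus_integral h"
  unfolding torus_integral_def
  by (subst integral_add) (auto intro!: integrable_torus continuous_intros assms)

lemma torus_integral_mult: "torus_integral (\<lambda>z. c * g z) = c * torus_integral g"
  unfolding torus_integral_def by simp

lemma torus_integral_bound:
  assumes "continuous_on UNIV g" "\<And>z. cmod (g z) \<le> B"
  shows "cmod (torus_integral g) \<le> (2 * pi)\<^sup>2 * B"
proof -
  have "0 \<le> B" using assms(2) norm_ge_zero order_trans by blast
  from integrable_bound[OF this integrable_torus[OF assms(1)]] assms(2) show ?thesis
    by (simp add: torus_integral_def content_Pair power2_eq_square mult_ac)
qed

lemma integral_periodic_derivative:
  fixes g :: "real \<Rightarrow> complex"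
  assumes "\<And>s. (g has_vector_derivative g' s) (at s)" "g c = g 0" "0 \<le> c"
  shows "integral {0..c} g' = 0"
proof -
  have "(g' has_integral (g c - g 0)) {0..c}"
    using assms by (intro fundamental_theorem_of_calculus) (auto intro: has_vector_derivative_at_within)
  then show ?thesis using assms by (simp add: integral_unique)
qed

text \<open>Fubini allows integrating first in the variable of differentiation; that inner integral
  is a difference of two values of \<open>g\<close> one period apart.\<close>

lemma torus_integral_derivative:
  assumes "continuous_on UNIV g'" "biperiodic g"
  shows torus_integral_deriv_t:
      "(\<And>t x. ((\<lambda>s. g (s, x)) has_vector_derivative g' (t, x)) (at t)) \<Longrightarrow> torus_integral g' = 0"
    and torus_integral_deriv_x:
      "(\<And>t x. ((\<lambda>y. g (t, y)) has_vector_derivative g' (t, x)) (at x)) \<Longrightarrow> torus_integral g' = 0"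
proof -
  have c: "continuous_on (cbox (0, 0) (2 * pi, 2 * pi)) g'"
    using assms(1) continuous_on_subset by blast
  have p: "g (2 * pi, x) = g (0, x)" "g (t, 2 * pi) = g (t, 0)" for t x
    using biperiodicD(1)[OF assms(2), of 0] biperiodicD(2)[OF assms(2), of _ 0] by simp_all
  have tx: "torus_integral g' = integral {0..2*pi} (\<lambda>t. integral {0..2*pi} (\<lambda>x. g' (t, x)))"
    unfolding torus_integral_def by (subst integral_prod_continuous[OF c]) simp
  also have xt: "\<dots> = integral {0..2*pi} (\<lambda>x. integral {0..2*pi} (\<lambda>t. g' (t, x)))"
    using integral_swap_continuous[of 0 0 "2*pi" "2*pi" "\<lambda>t x. g' (t, x)"] c by simp
  finally show "torus_integral g' = 0"
    if "\<And>t x. ((\<lambda>s. g (s, x)) has_vector_derivative g' (t, x)) (at t)"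
    using integral_periodic_derivative[OF that p(1)] by simp
  show "torus_integral g' = 0"
    if "\<And>t x. ((\<lambda>y. g (t, y)) has_vector_derivative g' (t, x)) (at x)"
    using tx integral_periodic_derivative[OF that p(2)] by simp
qed

text \<open>Multiplied by \<i>\<tau> or \<i>\<xi>, the exponential is a partial derivative of itself
  and so has integral zero. Only the zero frequency escapes, where the integral is the area of the
  square.\<close>

lemma torus_integral_exp:
  "torus_integral (torus_exp \<tau> \<xi>) = (if \<tau> = 0 \<and> \<xi> = 0 then complex_of_real ((2 * pi)\<^sup>2) else 0)"
proof -
  have "torus_integral (\<lambda>z. \<i> * of_int \<tau> * torus_exp \<tau> \<xi> z) = 0"
    by (rule torus_integral_deriv_t[OF _ biperiodic_torus_exp])
       (auto intro!: continuous_intros torus_exp_deriv)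
  moreover have "torus_integral (\<lambda>z. \<i> * of_int \<xi> * torus_exp \<tau> \<xi> z) = 0"
    by (rule torus_integral_deriv_x[OF _ biperiodic_torus_exp])
       (auto intro!: continuous_intros torus_exp_deriv)
  moreover have "torus_integral (torus_exp 0 0) = complex_of_real ((2 * pi)\<^sup>2)"
    by (simp add: torus_integral_def torus_exp_def split_beta' content_Pair power2_eq_square
        scaleR_conv_of_real)
  ultimately show ?thesis by (auto simp: torus_integral_mult)
qed

section \<open>Fourier integrals of test functions\<close>

definition fourier_integral :: "(real \<times> real \<Rightarrow> complex) \<Rightarrow> int \<Rightarrow> int \<Rightarrow> complex" where
  "fourier_integral \<phi> \<tau> \<xi> = torus_integral (\<lambda>z. \<phi> z * torus_exp \<tau> \<xi> z)"

lemma continuous_on_mult_torus_exp: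
  "\<phi> \<in> test_functions \<Longrightarrow> continuous_on UNIV (\<lambda>z. \<phi> z * torus_exp \<tau> \<xi> z)"
  by (intro continuous_intros test_function_continuous)

lemma fourier_integral_linear:
  assumes "\<phi> \<in> test_functions" "\<psi> \<in> test_functions"
  shows "fourier_integral (\<lambda>z. c * \<phi> z + d * \<psi> z) \<tau> \<xi>
    = c * fourier_integral \<phi> \<tau> \<xi> + d * fourier_integral \<psi> \<tau> \<xi>"
  using torus_integral_linear[OF assms[THEN continuous_on_mult_torus_exp], of c \<tau> \<xi> d]
  by (simp add: fourier_integral_def algebra_simps)

text \<open>Integration by parts: the derivative of the product of \<open>\<phi>\<close> and the
  exponential has integral zero, with no boundary terms by periodicity.\<close>

lemma fourier_integral_deriv:
  assumes "\<phi> \<in> test_functions"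
  shows "fourier_integral (deriv_t \<phi>) \<tau> \<xi> = - \<i> * of_int \<tau> * fourier_integral \<phi> \<tau> \<xi>"
    and "fourier_integral (deriv_x \<phi>) \<tau> \<xi> = - \<i> * of_int \<xi> * fourier_integral \<phi> \<tau> \<xi>"
proof -
  note c = continuous_on_mult_torus_exp[OF assms]
    continuous_on_mult_torus_exp[OF test_functions_deriv(1)[OF assms]]
    continuous_on_mult_torus_exp[OF test_functions_deriv(2)[OF assms]]
  have b: "biperiodic (\<lambda>z. \<phi> z * torus_exp \<tau> \<xi> z)"
    using test_function_biperiodic[OF assms] biperiodic_torus_exp by (simp add: biperiodic_def)
  \<comment> \<open>The factor \<open>1\<close> brings the integrand into the shape of
    \<open>torus_integral_linear\<close>.\<close>
  have "torus_integral (\<lambda>z. 1 * (deriv_t \<phi> z * torus_exp \<tau> \<xi> z) + \<i> * of_int \<tau> * (\<phi> z * torus_exp \<tau> \<xi> z)) = 0"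
    by (rule torus_integral_deriv_t[OF _ b])
       (auto intro!: continuous_on_add continuous_on_mult_left c derivative_eq_intros
         test_function_differentiable[OF assms] torus_exp_deriv simp: algebra_simps)
  then show "fourier_integral (deriv_t \<phi>) \<tau> \<xi> = - \<i> * of_int \<tau> * fourier_integral \<phi> \<tau> \<xi>"
    unfolding torus_integral_linear[OF c(2,1)] by (simp add: fourier_integral_def add_eq_0_iff2)
  have "torus_integral (\<lambda>z. 1 * (deriv_x \<phi> z * torus_exp \<tau> \<xi> z) + \<i> * of_int \<xi> * (\<phi> z * torus_exp \<tau> \<xi> z)) = 0"
    by (rule torus_integral_deriv_x[OF _ b])
       (auto intro!: continuous_on_add continuous_on_mult_left c derivative_eq_intros
         test_function_differentiable[OF assms] torus_exp_deriv simp: algebra_simps)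
  then show "fourier_integral (deriv_x \<phi>) \<tau> \<xi> = - \<i> * of_int \<xi> * fourier_integral \<phi> \<tau> \<xi>"
    unfolding torus_integral_linear[OF c(3,1)] by (simp add: fourier_integral_def add_eq_0_iff2)
qed

text \<open>Each derivative in \<open>x\<close> contributes a factor of modulus |\<xi>|, and the
  integral of the \<open>N\<close>-th one is at most its supremum times the area. The bound is
  uniform in \<tau>.\<close>

lemma fourier_integral_decay:
  assumes "\<phi> \<in> test_functions"
  shows "\<bar>of_int \<xi>\<bar> ^ N * cmod (fourier_integral \<phi> \<tau> \<xi>) \<le> (2 * pi)\<^sup>2 * Ck_norm N \<phi>"
proof -
  have T: "(deriv_x ^^ j) \<phi> \<in> test_functions" for j
    using test_functions_funpow_deriv[OF assms, of 0] by simp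
  have "cmod (fourier_integral ((deriv_x ^^ j) \<phi>) \<tau> \<xi>) = \<bar>of_int \<xi>\<bar> ^ j * cmod (fourier_integral \<phi> \<tau> \<xi>)" for j
    by (induction j) (simp_all add: fourier_integral_deriv(2)[OF T] norm_mult)
  moreover have "cmod (fourier_integral ((deriv_x ^^ N) \<phi>) \<tau> \<xi>) \<le> (2 * pi)\<^sup>2 * Ck_norm N \<phi>"
    unfolding fourier_integral_def
    by (intro torus_integral_bound continuous_on_mult_torus_exp T)
       (simp add: norm_mult Ck_norm_deriv_x[OF assms])
  ultimately show ?thesis by simp
qed

subsection \<open>Lacunary Fourier series\<close>

text \<open>The functional of the formal sum of \<open>c n * torus_exp (p n) (int (q n))\<close>
  under the bilinear pairing; restricting it to test functions provides the extensionality that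
  \<open>distributions\<close> demands.\<close>

definition fourier_series ::
  "(nat \<Rightarrow> complex) \<Rightarrow> (nat \<Rightarrow> int) \<Rightarrow> (nat \<Rightarrow> nat) \<Rightarrow> (real \<times> real \<Rightarrow> complex) \<Rightarrow> complex" where
  "fourier_series c p q = (\<lambda>\<phi>\<in>test_functions. \<Sum>n. c n * fourier_integral \<phi> (p n) (int (q n)))"

definition poly_growth :: "(nat \<Rightarrow> complex) \<Rightarrow> (nat \<Rightarrow> nat) \<Rightarrow> bool" where
  "poly_growth c q \<longleftrightarrow> (\<exists>C M. \<forall>n. cmod (c n) \<le> C * real (q n) ^ M)"

text \<open>Growth of the coefficients is absorbed by integrating by parts in \<open>x\<close> only.\<close>

lemma fourier_series_term_bound:
  assumes "poly_growth c q" "\<And>n. q n > n"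
  obtains N C where "\<And>\<phi> \<tau> n. \<phi> \<in> test_functions \<Longrightarrow>
    cmod (c n * fourier_integral \<phi> \<tau> (int (q n))) \<le> (C * Ck_norm N \<phi>) * inverse (real (Suc n) ^ 2)"
proof -
  obtain C M where CM: "\<And>n. cmod (c n) \<le> C * real (q n) ^ M"
    using assms(1) by (auto simp: poly_growth_def)
  show thesis
  \<comment> \<open>\<open>M\<close> derivatives compensate the growth of the coefficients; two more
    gain a factor \<open>1 / q n ^ 2\<close>, which is summable because
    \<open>q n > n\<close>.\<close>
  proof (rule that[of "\<bar>C\<bar> * (2 * pi)\<^sup>2" "M + 2"])
    fix \<phi> n and \<tau> :: int assume \<phi>: "\<phi> \<in> test_functions"
    let ?F = "cmod (fourier_integral \<phi> \<tau> (int (q n)))"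
    have q: "real (Suc n) \<le> real (q n)" using assms(2)[of n] by linarith
    have "cmod (c n) \<le> \<bar>C\<bar> * real (q n) ^ M"
      using CM[of n] by (smt (verit) abs_ge_self mult_right_mono of_nat_0_le_iff zero_le_power)
    then have "cmod (c n) * ?F * real (Suc n) ^ 2 \<le> (\<bar>C\<bar> * real (q n) ^ M) * ?F * real (q n) ^ 2"
      using q by (intro mult_mono power_mono) auto
    also have "\<dots> = \<bar>C\<bar> * (real (q n) ^ (M + 2) * ?F)"
      by (simp add: power_add power2_eq_square mult_ac)
    also have "\<dots> \<le> \<bar>C\<bar> * ((2 * pi)\<^sup>2 * Ck_norm (M + 2) \<phi>)"
      using fourier_integral_decay[OF \<phi>, of "int (q n)" "M + 2" \<tau>] by (intro mult_left_mono) auto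
    finally show "cmod (c n * fourier_integral \<phi> \<tau> (int (q n)))
        \<le> \<bar>C\<bar> * (2 * pi)\<^sup>2 * Ck_norm (M + 2) \<phi> * inverse (real (Suc n) ^ 2)"
      by (simp add: norm_mult field_simps)
  qed
qed

lemma summable_inverse_Suc_squares: "summable (\<lambda>n. inverse (real (Suc n) ^ 2))"
  using inverse_power_summable[of 2, where ?'a = real] by (subst summable_Suc_iff) simp

lemma fourier_series_summable:
  assumes "poly_growth c q" "\<And>n. q n > n" "\<phi> \<in> test_functions"
  shows "summable (\<lambda>n. c n * fourier_integral \<phi> (p n) (int (q n)))"
proof (rule fourier_series_term_bound[OF assms(1,2)])
  fix N C
  assume "\<And>\<phi> \<tau> n. \<phi> \<in> test_functions \<Longrightarrow>
    cmod (c n * fourier_integral \<phi> \<tau> (int (q n))) \<le> (C * Ck_norm N \<phi>) * inverse (real (Suc n) ^ 2)"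
  from this[OF assms(3)] show ?thesis
    by (rule summable_comparison_test'[OF summable_mult[OF summable_inverse_Suc_squares]])
qed

text \<open>In the termwise bound \<open>N\<close> and \<open>C\<close> do not depend on the test
  function, so summing it over \<open>n\<close> gives the continuity estimate.\<close>

lemma fourier_series_distribution:
  assumes "poly_growth c q" "\<And>n. q n > n"
  shows "fourier_series c p q \<in> distributions"
proof -
  note sm = fourier_series_summable[OF assms, of _ p]
  have lin: "fourier_series c p q (\<lambda>z. a * \<phi> z + b * \<psi> z)
      = a * fourier_series c p q \<phi> + b * fourier_series c p q \<psi>"
    if "\<phi> \<in> test_functions" "\<psi> \<in> test_functions" for a b \<phi> \<psi>
  proof -
    let ?F = "\<lambda>\<phi> n. c n * fourier_integral \<phi> (p n) (int (q n))"
    have "fourier_series c p q (\<lambda>z. a * \<phi> z + b * \<psi> z) = (\<Sum>n. a * ?F \<phi> n + b * ?F \<psi> n)"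
      using that by (simp add: fourier_series_def test_functions_linear fourier_integral_linear algebra_simps)
    also have "\<dots> = a * (\<Sum>n. ?F \<phi> n) + b * (\<Sum>n. ?F \<psi> n)"
      using that[THEN sm]
      by (simp only: suminf_add[symmetric] suminf_mult[symmetric] summable_mult)
    finally show ?thesis
      using that by (simp add: fourier_series_def)
  qed
  obtain N C where b: "\<And>\<phi> n. \<phi> \<in> test_functions \<Longrightarrow>
    cmod (c n * fourier_integral \<phi> (p n) (int (q n))) \<le> (C * Ck_norm N \<phi>) * inverse (real (Suc n) ^ 2)"
    using fourier_series_term_bound[OF assms] by metis
  have "cmod (fourier_series c p q \<phi>) \<le> C * (\<Sum>n. inverse (real (Suc n) ^ 2)) * Ck_norm N \<phi>"
    if "\<phi> \<in> test_functions" for \<phi>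
  proof -
    have "cmod (fourier_series c p q \<phi>) \<le> (\<Sum>n. (C * Ck_norm N \<phi>) * inverse (real (Suc n) ^ 2))"
      using that unfolding fourier_series_def restrict_apply'[OF that]
      by (intro norm_suminf_le b summable_mult summable_inverse_Suc_squares)
    then show ?thesis
      by (subst (asm) suminf_mult[OF summable_inverse_Suc_squares]) (simp add: mult_ac)
  qed
  then have "\<exists>N C. \<forall>\<phi>\<in>test_functions. cmod (fourier_series c p q \<phi>) \<le> C * Ck_norm N \<phi>" by blast
  moreover have "fourier_series c p q (\<lambda>z. \<phi> z + \<psi> z) = fourier_series c p q \<phi> + fourier_series c p q \<psi>"
    if "\<phi> \<in> test_functions" "\<psi> \<in> test_functions" for \<phi> \<psi>
    using lin[OF that, of 1 1] by simp
  moreover have "fourier_series c p q (\<lambda>z. a * \<phi> z) = a * fourier_series c p q \<phi>"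
    if "\<phi> \<in> test_functions" for a \<phi>
    using lin[OF that that, of a 0] by simp
  moreover have "fourier_series c p q \<in> extensional test_functions"
    unfolding fourier_series_def by simp
  ultimately show ?thesis
    unfolding distributions_def by blast
qed

text \<open>Testing against the opposite frequency leaves, by orthogonality, only the terms of
  frequency (\<tau>, \<xi>). Strict monotonicity of \<open>q\<close> allows at most one of
  them.\<close>

lemma dist_fourier_fourier_series:
  assumes "strict_mono q"
  shows "dist_fourier (fourier_series c p q) (p n) (int (q n)) = c n"
    and "(\<tau>, \<xi>) \<notin> range (\<lambda>n. (p n, int (q n))) \<Longrightarrow> dist_fourier (fourier_series c p q) \<tau> \<xi> = 0"
proof -
  have *: "fourier_series c p q (torus_exp (- \<tau>) (- \<xi>))
      = (\<Sum>m. c m * (if p m = \<tau> \<and> int (q m) = \<xi> then complex_of_real ((2 * pi)\<^sup>2) else 0))" for \<tau> \<xi>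
    using torus_integral_exp
    by (auto simp: fourier_series_def test_functions_torus_exp fourier_integral_def torus_exp_mult
        intro!: suminf_cong)
  have "(\<Sum>m. c m * (if p m = p n \<and> int (q m) = int (q n) then complex_of_real ((2 * pi)\<^sup>2) else 0))
      = c n * complex_of_real ((2 * pi)\<^sup>2)"
    by (subst suminf_finite[of "{n}"]) (auto simp: strict_mono_eq[OF assms])
  then show "dist_fourier (fourier_series c p q) (p n) (int (q n)) = c n"
    unfolding dist_fourier_def * by simp
  show "dist_fourier (fourier_series c p q) \<tau> \<xi> = 0" if "(\<tau>, \<xi>) \<notin> range (\<lambda>n. (p n, int (q n)))"
    unfolding dist_fourier_def * using that by (subst suminf_finite[of "{}"]) auto
qed

text \<open>The coefficients vanish off the injectively indexed frequencies, and for nonnegative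
  terms unconditional and ordinary summability agree.\<close>

lemma fourier_series_H_mix_iff:
  assumes "poly_growth c q" "\<And>n. q n > n" "strict_mono q"
  shows "fourier_series c p q \<in> H_mix s1 s2 \<longleftrightarrow>
    summable (\<lambda>n. jap (of_int (p n)) powr (2 * s1) * jap (of_nat (q n)) powr (2 * s2) * (cmod (c n))\<^sup>2)"
    (is "_ \<longleftrightarrow> summable ?g")
proof -
  let ?h = "\<lambda>(\<tau>, \<xi>). jap (of_int \<tau>) powr (2 * s1) * jap (of_int \<xi>) powr (2 * s2) *
    (cmod (dist_fourier (fourier_series c p q) \<tau> \<xi>))\<^sup>2"
  let ?P = "\<lambda>n. (p n, int (q n))"
  have "inj ?P" using strict_mono_eq[OF assms(3)] by (auto simp: inj_on_def)
  have "?h summable_on UNIV \<longleftrightarrow> ?h summable_on range ?P"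
    by (rule summable_on_cong_neutral) (auto simp: dist_fourier_fourier_series(2)[OF assms(3)])
  also have "\<dots> \<longleftrightarrow> (?h \<circ> ?P) summable_on UNIV"
    by (rule summable_on_reindex[OF \<open>inj ?P\<close>])
  also have "?h \<circ> ?P = ?g"
    by (simp add: fun_eq_iff dist_fourier_fourier_series(1)[OF assms(3)])
  also have "?g summable_on UNIV \<longleftrightarrow> summable ?g"
    by (rule summable_on_UNIV_nonneg_real_iff) simp
  finally show ?thesis
    using fourier_series_distribution[OF assms(1,2)] by (simp add: H_mix_def)
qed

text \<open>The minus sign of the distributional derivative cancels the one from integration by
  parts, so the operator acts on each term as multiplication by its symbol \<i>(p - a q).\<close>

lemma transport_op_fourier_series:
  assumes "poly_growth c q" "\<And>n. q n > n"
  shows "transport_op a (fourier_series c p q)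
    = fourier_series (\<lambda>n. \<i> * complex_of_real (of_int (p n) - a * of_nat (q n)) * c n) p q"
proof
  fix \<phi>
  show "transport_op a (fourier_series c p q) \<phi>
    = fourier_series (\<lambda>n. \<i> * complex_of_real (of_int (p n) - a * of_nat (q n)) * c n) p q \<phi>"
  proof (cases "\<phi> \<in> test_functions")
    case True
    note d = test_functions_deriv[OF True]
    note s = d[THEN fourier_series_summable[OF assms, of _ p]]
    have "transport_op a (fourier_series c p q) \<phi>
      = - (\<Sum>n. c n * fourier_integral (deriv_t \<phi>) (p n) (int (q n)))
        + complex_of_real a * (\<Sum>n. c n * fourier_integral (deriv_x \<phi>) (p n) (int (q n)))"
      by (simp add: transport_op_def dist_deriv_t_def dist_deriv_x_def fourier_series_def True d)
    also have "\<dots> = (\<Sum>n. - (c n * fourier_integral (deriv_t \<phi>) (p n) (int (q n)))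
        + complex_of_real a * (c n * fourier_integral (deriv_x \<phi>) (p n) (int (q n))))"
      by (simp only: suminf_minus[OF s(1), symmetric] suminf_mult[OF s(2), symmetric]
          suminf_add[OF summable_minus[OF s(1)] summable_mult[OF s(2)]])
    also have "\<dots> = fourier_series (\<lambda>n. \<i> * complex_of_real (of_int (p n) - a * of_nat (q n)) * c n) p q \<phi>"
      by (simp add: fourier_series_def True fourier_integral_deriv algebra_simps)
    finally show ?thesis .
  qed (simp add: transport_op_def fourier_series_def)
qed

subsection \<open>Comparison of weights\<close>

text \<open>The power \<open>s\<close> of \<open>y / x\<close> lies between those of
  \<open>m\<close> and \<open>M\<close>, in an order that depends on the sign of \<open>s\<close>;
  hence \<open>min\<close> and \<open>max\<close>.\<close>

lemma powr_comparable:
  fixes m M x y s :: real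
  assumes "0 < m" "0 < x" "m * x \<le> y" "y \<le> M * x"
  shows "min (m powr s) (M powr s) * x powr s \<le> y powr s"
    and "y powr s \<le> max (m powr s) (M powr s) * x powr s"
proof -
  have "m \<le> y / x" "y / x \<le> M" "0 < y / x" using assms by (auto simp: field_simps intro: less_le_trans[OF mult_pos_pos])
  then have "min (m powr s) (M powr s) \<le> (y / x) powr s \<and> (y / x) powr s \<le> max (m powr s) (M powr s)"
    using assms(1) by (cases "s \<ge> 0")
      (auto simp: min_le_iff_disj le_max_iff_disj intro: powr_mono2 powr_mono2')
  moreover have "y powr s = (y / x) powr s * x powr s"
    using assms \<open>0 < y / x\<close> by (subst powr_mult[symmetric]) (auto simp: zero_less_divide_iff)
  ultimately show "min (m powr s) (M powr s) * x powr s \<le> y powr s"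
    and "y powr s \<le> max (m powr s) (M powr s) * x powr s"
    by (auto intro!: mult_right_mono)
qed

lemma jap_bounds: "\<bar>w\<bar> \<le> jap w" "jap w \<le> 1 + \<bar>w\<bar>" "0 < jap w"
  unfolding jap_def
  by (auto intro!: real_le_rsqrt real_le_lsqrt simp: power2_eq_square algebra_simps add_pos_nonneg)

lemma jap_powr_double: "jap w powr (2 * s) = (jap w powr s)\<^sup>2"
  unfolding mult_2 powr_add power2_eq_square ..

subsection \<open>Lacunary rational approximations\<close>

text \<open>Bounded denominators would leave finitely many pairs: as \<open>q powr (- \<nu>)\<close>
  is at most 1, \<open>p / q\<close> stays within distance 1 of \<open>a\<close>, which bounds the
  numerators too.\<close>

lemma infinite_rational_approximations:
  fixes a \<nu> K :: real
  assumes "\<nu> > 0"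
    and inf: "infinite {(p :: int, q :: nat). q > 0 \<and> \<bar>a - of_int p / real q\<bar> < real q powr (- \<nu>)}"
  shows "\<exists>p q. real q > K \<and> q > 0 \<and> \<bar>a - of_int p / real q\<bar> < real q powr (- \<nu>)"
proof (rule ccontr)
  assume contr: "\<not> ?thesis"
  let ?B = "\<lceil>(\<bar>a\<bar> + 1) * \<bar>K\<bar>\<rceil>"
  have "p \<in> {- ?B..?B} \<and> q \<in> {..nat \<lceil>K\<rceil>}"
    if q: "q > 0" and app: "\<bar>a - of_int p / real q\<bar> < real q powr (- \<nu>)" for p q
  proof -
    have "real q \<le> K" using contr that by (meson not_le)
    have "real q powr (- \<nu>) \<le> 1 powr (- \<nu>)" using q assms(1) by (intro powr_mono2') auto
    then have "\<bar>of_int p / real q\<bar> \<le> \<bar>a\<bar> + 1" using app by simp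
    then have "\<bar>of_int p\<bar> \<le> (\<bar>a\<bar> + 1) * real q" using q by (simp add: abs_divide divide_le_eq)
    also have "\<dots> \<le> (\<bar>a\<bar> + 1) * \<bar>K\<bar>" using \<open>real q \<le> K\<close> by (intro mult_left_mono) auto
    finally have "\<bar>p\<bar> \<le> ?B" by linarith
    moreover have "q \<le> nat \<lceil>K\<rceil>" using \<open>real q \<le> K\<close> by linarith
    ultimately show ?thesis by auto
  qed
  then have "{(p :: int, q :: nat). q > 0 \<and> \<bar>a - of_int p / real q\<bar> < real q powr (- \<nu>)}
      \<subseteq> {- ?B..?B} \<times> {..nat \<lceil>K\<rceil>}" by blast
  then show False using inf finite_subset by blast
qed

lemma lacunary_rational_approximations:
  fixes a \<nu> K :: real
  assumes "\<nu> > 0"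
    and inf: "infinite {(p :: int, q :: nat). q > 0 \<and> \<bar>a - of_int p / real q\<bar> < real q powr (- \<nu>)}"
  obtains p :: "nat \<Rightarrow> int" and q :: "nat \<Rightarrow> nat"
  where "strict_mono q" "\<And>n. K < real (q n)" "\<And>n. 2 ^ n \<le> q n"
    "\<And>n. \<bar>a - of_int (p n) / real (q n)\<bar> < real (q n) powr (- \<nu>)"
proof -
  let ?P = "\<lambda>n (p, q). K < real q \<and> 2 ^ n \<le> q \<and> \<bar>a - of_int p / real q\<bar> < real q powr (- \<nu>)"
  have ex: "\<exists>y. ?P n y \<and> m < snd y" for n m
  proof -
    \<comment> \<open>One threshold secures all demands: beyond \<open>K\<close>, beyond
      \<open>2 ^ n\<close>, and beyond the previous denominator \<open>m\<close>.\<close>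
    obtain p q where "real q > max K (real (max m (2 ^ n)))" "\<bar>a - of_int p / real q\<bar> < real q powr (- \<nu>)"
      using infinite_rational_approximations[OF assms] by blast
    then show ?thesis by (intro exI[of _ "(p, q)"]) auto
  qed
  have "\<exists>f. \<forall>n. ?P n (f n) \<and> snd (f n) < snd (f (Suc n))"
    using ex by (intro dependent_nat_choice) blast+
  then obtain f where f: "\<forall>n. ?P n (f n) \<and> snd (f n) < snd (f (Suc n))" ..
  show thesis
    by (rule that[of "\<lambda>n. snd (f n)" "\<lambda>n. fst (f n)"]) (use f in \<open>auto simp: strict_mono_Suc_iff split_beta\<close>)
qed

section \<open>Construction of the irregular solution\<close>

lemma irrationality_measure_exponent:
  assumes "ereal r < irrationality_measure a"
  obtains \<nu> where "r < \<nu>" "\<nu> > 0"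
    "infinite {(p :: int, q :: nat). q > 0 \<and> \<bar>a - of_int p / real q\<bar> < real q powr (- \<nu>)}"
  using assms that unfolding irrationality_measure_def less_Sup_iff by auto

theorem proposition4p5:
  fixes a r :: real
  assumes "a \<notin> \<rat>"
    and "irrationality_measure a < \<infinity>"
    and "ereal r < irrationality_measure a"
  shows "\<forall>k1 k2 :: real. \<exists>f \<in> H_mix k1 k2. \<exists>u \<in> distributions.
           transport_op a u = f \<and>
           (\<forall>\<theta> :: real. u \<notin> H_mix (k1 + \<theta>) (k2 + 1 - r - \<theta>)) \<and>
           (\<forall>\<theta> \<in> {- r..1}. u \<notin> H_mix (k1 + \<theta>) (k2 + 1 - r - \<theta>))"
proof (intro allI)
  fix k1 k2 :: real
  obtain \<nu> where \<nu>: "r < \<nu>" "\<nu> > 0"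
    "infinite {(p :: int, q :: nat). q > 0 \<and> \<bar>a - of_int p / real q\<bar> < real q powr (- \<nu>)}"
    using irrationality_measure_exponent[OF assms(3)] by blast
  have "a \<noteq> 0" using assms(1) by auto
  \<comment> \<open>Beyond a suitable \<open>K\<close> the approximation error is below |a|/2, which
    keeps |p|/q between |a|/2 and 2|a|.\<close>
  have "((\<lambda>x :: real. x powr (- \<nu>)) \<longlongrightarrow> 0) at_top"
    using \<nu>(2) by (intro tendsto_neg_powr filterlim_ident) auto
  then have "eventually (\<lambda>x :: real. x powr (- \<nu>) < \<bar>a\<bar> / 2) at_top"
    using \<open>a \<noteq> 0\<close> by (intro order_tendstoD) auto
  then obtain K where K: "\<And>x :: real. K < x \<Longrightarrow> x powr (- \<nu>) < \<bar>a\<bar> / 2"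
    by (auto simp: eventually_at_top_dense)
  obtain p q where mono: "strict_mono q" and Kq: "\<And>n. K < real (q n)" and q2: "\<And>n. 2 ^ n \<le> q n"
    and app: "\<And>n. \<bar>a - of_int (p n) / real (q n)\<bar> < real (q n) powr (- \<nu>)"
    using lacunary_rational_approximations[OF \<nu>(2,3)] by metis
  have qn: "n < q n" for n using q2[of n] less_exp[of n] by linarith
  have q1: "1 \<le> real (q n)" for n using qn[of n] by linarith
  have q0: "0 < real (q n)" for n using q1[of n] by linarith

  define \<delta> where "\<delta> n = of_int (p n) - a * real (q n)" for n
  have \<delta>: "\<bar>\<delta> n\<bar> \<le> real (q n) powr (1 - \<nu>)" for n
  proof -
    have "\<bar>\<delta> n\<bar> = real (q n) * \<bar>a - of_int (p n) / real (q n)\<bar>"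
      unfolding \<delta>_def using q0[of n] by (simp add: abs_mult_pos' right_diff_distrib abs_minus_commute mult_ac)
    also have "\<dots> \<le> real (q n) * real (q n) powr (- \<nu>)"
      using app[of n] by (intro mult_left_mono) auto
    also have "\<dots> = real (q n) powr (1 - \<nu>)"
      using q0[of n] powr_add[of "real (q n)" 1 "- \<nu>"] by simp
    finally show ?thesis .
  qed

  \<comment> \<open>Chosen to serve both \<open>jap q\<close> (between q and 2q) and
    \<open>jap p\<close> (between |a|q/2 and 1 + 2|a|q).\<close>
  define m M where "m = min 1 (\<bar>a\<bar> / 2)" and "M = 2 + 2 * \<bar>a\<bar>"
  have "m > 0" using \<open>a \<noteq> 0\<close> by (simp add: m_def)
  have jq: "m * real (q n) \<le> jap (real (q n))" "jap (real (q n)) \<le> M * real (q n)" for n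
  proof -
    have "m * real (q n) \<le> 1 * real (q n)" by (intro mult_right_mono) (auto simp: m_def)
    then show "m * real (q n) \<le> jap (real (q n))" using jap_bounds(1)[of "real (q n)"] by simp
    have "2 * real (q n) \<le> M * real (q n)" by (intro mult_right_mono) (auto simp: M_def)
    then show "jap (real (q n)) \<le> M * real (q n)" using jap_bounds(2)[of "real (q n)"] q1[of n] by linarith
  qed
  have jp: "m * real (q n) \<le> jap (of_int (p n))" "jap (of_int (p n)) \<le> M * real (q n)" for n
  proof -
    have "\<bar>a - of_int (p n) / real (q n)\<bar> < \<bar>a\<bar> / 2"
      using app[of n] K[OF Kq[of n]] by linarith
    then have "\<bar>a\<bar> / 2 \<le> \<bar>of_int (p n) / real (q n)\<bar>" "\<bar>of_int (p n) / real (q n)\<bar> \<le> 2 * \<bar>a\<bar>" by linarith+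
    then have *: "\<bar>a\<bar> / 2 * real (q n) \<le> \<bar>of_int (p n)\<bar>" "\<bar>of_int (p n)\<bar> \<le> 2 * \<bar>a\<bar> * real (q n)"
      using q0[of n] by (simp_all add: abs_divide field_simps)
    have "m * real (q n) \<le> \<bar>a\<bar> / 2 * real (q n)" by (intro mult_right_mono) (auto simp: m_def)
    then show "m * real (q n) \<le> jap (of_int (p n))"
      using * jap_bounds(1)[of "of_int (p n)"] by linarith
    show "jap (of_int (p n)) \<le> M * real (q n)"
      using * jap_bounds(2)[of "of_int (p n)"] q1[of n] by (simp add: M_def algebra_simps)
  qed
  note cp = powr_comparable[OF \<open>m > 0\<close> q0 jp] and cq = powr_comparable[OF \<open>m > 0\<close> q0 jq]

  \<comment> \<open>The first two factors cancel the weights of order \<open>k1\<close> and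
    \<open>k2\<close>; the last one balances the remaining weight of total order
    \<open>1 - r\<close>.\<close>
  define c where "c n = jap (of_int (p n)) powr (- k1) * jap (real (q n)) powr (- k2) * real (q n) powr (r - 1)" for n
  let ?c = "\<lambda>n. complex_of_real (c n)"
  let ?d = "\<lambda>n. \<i> * complex_of_real (of_int (p n) - a * of_nat (q n)) * ?c n"
  have c0: "0 \<le> c n" for n by (simp add: c_def)
  have growth_c: "\<exists>C N. \<forall>n. c n \<le> C * real (q n) ^ N"
  proof -
    let ?C1 = "max (m powr (- k1)) (M powr (- k1))" and ?C2 = "max (m powr (- k2)) (M powr (- k2))"
    let ?e = "- k1 + - k2 + (r - 1)"
    have C: "0 \<le> ?C1" "0 \<le> ?C2" by (simp_all add: le_max_iff_disj)
    have "c n \<le> (?C1 * ?C2) * real (q n) ^ nat \<lceil>?e\<rceil>" for n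
    proof -
      have "c n \<le> (?C1 * real (q n) powr (- k1)) * (?C2 * real (q n) powr (- k2)) * real (q n) powr (r - 1)"
        unfolding c_def by (intro mult_mono cp cq mult_nonneg_nonneg C) auto
      also have "\<dots> = (?C1 * ?C2) * real (q n) powr ?e"
        unfolding powr_add by (simp add: mult_ac)
      \<comment> \<open>Since \<open>q n\<close> is at least 1, rounding the exponent up to a
        natural number only enlarges the power.\<close>
      also have "real (q n) powr ?e \<le> real (q n) powr real (nat \<lceil>?e\<rceil>)"
        using q1[of n] by (intro powr_mono) linarith+
      also have "\<dots> = real (q n) ^ nat \<lceil>?e\<rceil>" using q0[of n] by (simp add: powr_realpow)
      finally show ?thesis using C by (simp add: mult_left_mono)
    qed
    then show ?thesis by blast
  qed
  then obtain C N where CN: "\<And>n. c n \<le> C * real (q n) ^ N" by blast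
  have c_growth: "poly_growth ?c q"
    unfolding poly_growth_def using CN c0 by (auto intro!: exI[of _ C] exI[of _ N])
  have norm_d: "cmod (?d n) = \<bar>\<delta> n\<bar> * c n" for n
    using c0[of n] by (simp add: norm_mult \<delta>_def del: of_real_diff of_real_mult)
  have "cmod (?d n) \<le> C * real (q n) ^ Suc N" for n
  proof -
    have "\<bar>\<delta> n\<bar> \<le> real (q n) powr 1"
      using \<nu>(2) q1[of n] by (intro order_trans[OF \<delta>] powr_mono) auto
    then have "\<bar>\<delta> n\<bar> * c n \<le> real (q n) * (C * real (q n) ^ N)"
      using c0 CN q0[of n] by (intro mult_mono) auto
    then show ?thesis unfolding norm_d by (simp add: mult_ac)
  qed
  then have d_growth: "poly_growth ?d q" unfolding poly_growth_def by blast

  define u where "u = fourier_series ?c p q"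
  define f where "f = fourier_series ?d p q"
  have "transport_op a u = f"
    unfolding u_def f_def by (rule transport_op_fourier_series[OF c_growth qn])
  moreover have "u \<in> distributions"
    unfolding u_def by (rule fourier_series_distribution[OF c_growth qn])
  moreover have "f \<in> H_mix k1 k2"
  proof -
    let ?g = "\<lambda>n. jap (of_int (p n)) powr (2 * k1) * jap (real (q n)) powr (2 * k2) * (cmod (?d n))\<^sup>2"
    have "?g n \<le> (2 powr (- (2 * (\<nu> - r)))) ^ n" for n
    proof -
      have "?g n = (real (q n) powr (r - 1) * \<bar>\<delta> n\<bar>)\<^sup>2"
        using jap_bounds(3)[of "of_int (p n)"] jap_bounds(3)[of "real (q n)"]
        unfolding norm_d unfolding c_def jap_powr_double
        by (simp add: powr_minus power_mult_distrib field_simps)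
      also have "\<dots> \<le> (real (q n) powr (r - 1) * real (q n) powr (1 - \<nu>))\<^sup>2"
        by (intro power_mono mult_left_mono \<delta>) auto
      also have "\<dots> = real (q n) powr (- (2 * (\<nu> - r)))"
        by (simp add: power2_eq_square algebra_simps flip: powr_add)
      \<comment> \<open>The exponent is negative because \<open>r < \<nu>\<close>, so
        \<open>2 ^ n \<le> q n\<close> yields geometric decay.\<close>
      also have "\<dots> \<le> (2 ^ n) powr (- (2 * (\<nu> - r)))"
        using q2[of n] \<nu>(1) by (intro powr_mono2') (auto simp: numeral_power_le_of_nat_cancel_iff)
      also have "\<dots> = (2 powr (- (2 * (\<nu> - r)))) ^ n"
        by (simp add: powr_powr mult.commute flip: powr_realpow)
      finally show ?thesis .
    qed
    moreover have "(2 :: real) powr (- (2 * (\<nu> - r))) < 1"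
      using \<nu>(1) powr_less_mono[of "- (2 * (\<nu> - r))" 0 "2 :: real"] by simp
    ultimately have "summable ?g"
      by (intro summable_comparison_test'[OF summable_geometric[of "2 powr (- (2 * (\<nu> - r)))"], of 0]) auto
    then show ?thesis
      unfolding f_def fourier_series_H_mix_iff[OF d_growth qn mono] .
  qed
  moreover have "u \<notin> H_mix (k1 + \<theta>) (k2 + 1 - r - \<theta>)" for \<theta>
  proof
    let ?g = "\<lambda>n. jap (of_int (p n)) powr (2 * (k1 + \<theta>)) *
        jap (real (q n)) powr (2 * (k2 + 1 - r - \<theta>)) * (cmod (?c n))\<^sup>2"
    \<comment> \<open>What remains of the exponent of \<open>jap (q n)\<close> once
      \<open>c n\<close> has cancelled \<open>k2\<close>; together with \<open>\<theta>\<close> and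
      \<open>r - 1\<close> it adds up to zero.\<close>
    let ?s = "1 - r - \<theta>"
    let ?A = "min (m powr \<theta>) (M powr \<theta>)" and ?B = "min (m powr ?s) (M powr ?s)"
    have "0 < M" by (simp add: M_def add_pos_nonneg)
    then have pos: "0 < ?A" "0 < ?B" using \<open>m > 0\<close> by auto
    have lower: "(?A * ?B)\<^sup>2 \<le> ?g n" for n
    proof -
      have one: "real (q n) powr \<theta> * real (q n) powr ?s * real (q n) powr (r - 1) = 1"
        using q0[of n] by (simp flip: powr_add)
      have "?A * ?B = ?A * ?B * (real (q n) powr \<theta> * real (q n) powr ?s * real (q n) powr (r - 1))"
        unfolding one by simp
      also have "\<dots> = (?A * real (q n) powr \<theta>) * (?B * real (q n) powr ?s) * real (q n) powr (r - 1)"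
        by (simp only: mult_ac)
      also have "\<dots> \<le> jap (of_int (p n)) powr \<theta> * jap (real (q n)) powr ?s * real (q n) powr (r - 1)"
        using pos by (intro mult_mono cp cq) auto
      finally have "(?A * ?B)\<^sup>2 \<le> (jap (of_int (p n)) powr \<theta> * jap (real (q n)) powr ?s * real (q n) powr (r - 1))\<^sup>2"
        using pos by (intro power_mono) auto
      also have "\<dots> = ?g n"
      proof -
        have "jap (of_int (p n)) powr \<theta> = jap (of_int (p n)) powr (k1 + \<theta>) * jap (of_int (p n)) powr (- k1)"
          by (simp flip: powr_add)
        moreover have "jap (real (q n)) powr ?s = jap (real (q n)) powr (k2 + 1 - r - \<theta>) * jap (real (q n)) powr (- k2)"
          by (simp add: algebra_simps flip: powr_add)
        moreover have "cmod (?c n) = c n" using c0[of n] by simp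
        ultimately show ?thesis
          unfolding jap_powr_double by (simp only: c_def power_mult_distrib mult_ac)
      qed
      finally show ?thesis .
    qed
    assume "u \<in> H_mix (k1 + \<theta>) (k2 + 1 - r - \<theta>)"
    then have "summable ?g"
      unfolding u_def fourier_series_H_mix_iff[OF c_growth qn mono] .
    \<comment> \<open>Terms of a convergent series tend to zero, contrary to their positive lower
      bound independent of \<open>n\<close>.\<close>
    then have "?g \<longlonglongrightarrow> 0" by (rule summable_LIMSEQ_zero)
    then have "(?A * ?B)\<^sup>2 \<le> 0"
      by (rule tendsto_lowerbound) (use lower in auto)
    then show False using pos by (simp add: not_le[symmetric])
  qed
  ultimately show "\<exists>f \<in> H_mix k1 k2. \<exists>u \<in> distributions.
           transport_op a u = f \<and>
           (\<forall>\<theta> :: real. u \<notin> H_mix (k1 + \<theta>) (k2 + 1 - r - \<theta>)) \<and>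
           (\<forall>\<theta> \<in> {- r..1}. u \<notin> H_mix (k1 + \<theta>) (k2 + 1 - r - \<theta>))"
    by blast
qed

end
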